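(* Let $G$ be a simply connected Lie group of dimension $n$ equipped with a left-invariant Riemannian metric $h$. There exists no nontrivial (i.e. nonzero) left-invariant concurrent vector field on $(G,h)$.
   Context: A vector field $X$ on a Riemannian manifold $(M,g)$ with Levi-Civita connection $\nabla$ is called concurrent if $\nabla_YX=Y$ for every vector field $Y$ on $M$. *)

theory Defs
  imports "HOL-Analysis.Analysis" "HOL-Algebra.Group"
begin

text \<open>
  Manifolds are modelled on the library's \<^term>\<open>Euclidean_space n\<close>, whose points are the
  sequences vanishing from index \<open>n\<close> on. The dimension is thus an ordinary natural number,
  and \<open>0\<close> is allowed.
\<close>

definition partial_deriv :: "nat \<Rightarrow> ((nat \<Rightarrow> real) \<Rightarrow> real) \<Rightarrow> (nat \<Rightarrow> real) \<Rightarrow> real" where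
  "partial_deriv i f x = deriv (\<lambda>t. f (x(i := t))) (x i)"

text \<open>\<open>Ck_on n k U f\<close>: \<open>f\<close> is of class \<open>C^k\<close> on the open subset \<open>U\<close> of \<^term>\<open>Euclidean_space n\<close>.\<close>

fun Ck_on :: "nat \<Rightarrow> nat \<Rightarrow> (nat \<Rightarrow> real) set \<Rightarrow> ((nat \<Rightarrow> real) \<Rightarrow> real) \<Rightarrow> bool" where
  "Ck_on n 0 U f \<longleftrightarrow> continuous_map (subtopology (Euclidean_space n) U) euclideanreal f"
| "Ck_on n (Suc k) U f \<longleftrightarrow>
     continuous_map (subtopology (Euclidean_space n) U) euclideanreal f \<and>
     (\<forall>i<n. (\<forall>x\<in>U. (\<lambda>t. f (x(i := t))) field_differentiable (at (x i))) \<and>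
            Ck_on n k U (partial_deriv i f))"

definition smooth_on :: "nat \<Rightarrow> (nat \<Rightarrow> real) set \<Rightarrow> ((nat \<Rightarrow> real) \<Rightarrow> real) \<Rightarrow> bool" where
  "smooth_on n U f \<longleftrightarrow> (\<forall>k. Ck_on n k U f)"

text \<open>
  A chart is a pair of its domain \<open>U\<close> and its coordinate map. The atlas need not be maximal;
  all notions below depend only on the smooth structure that it generates.
\<close>

record 'a manifold =
  mtop :: "'a topology"
  mdim :: nat
  atlas :: "('a set \<times> ('a \<Rightarrow> nat \<Rightarrow> real)) set"

definition is_chart :: "'a topology \<Rightarrow> nat \<Rightarrow> 'a set \<Rightarrow> ('a \<Rightarrow> nat \<Rightarrow> real) \<Rightarrow> bool" where
  "is_chart T n U \<phi> \<longleftrightarrow>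
     openin T U \<and> openin (Euclidean_space n) (\<phi> ` U) \<and>
     homeomorphic_map (subtopology T U) (subtopology (Euclidean_space n) (\<phi> ` U)) \<phi>"

definition smooth_manifold :: "'a manifold \<Rightarrow> bool" where
  "smooth_manifold M \<longleftrightarrow>
     Hausdorff_space (mtop M) \<and> second_countable (mtop M) \<and>
     (\<forall>(U, \<phi>) \<in> atlas M. is_chart (mtop M) (mdim M) U \<phi>) \<and>
     \<Union> (fst ` atlas M) = topspace (mtop M) \<and>
     (\<forall>(U, \<phi>) \<in> atlas M. \<forall>(V, \<psi>) \<in> atlas M. \<forall>k < mdim M.
        smooth_on (mdim M) (\<phi> ` (U \<inter> V)) (\<lambda>x. \<psi> (inv_into U \<phi> x) k))"

definition smooth_map :: "'a manifold \<Rightarrow> 'b manifold \<Rightarrow> ('a \<Rightarrow> 'b) \<Rightarrow> bool" where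
  "smooth_map M N F \<longleftrightarrow>
     continuous_map (mtop M) (mtop N) F \<and>
     (\<forall>(U, \<phi>) \<in> atlas M. \<forall>(V, \<psi>) \<in> atlas N. \<forall>k < mdim N.
        smooth_on (mdim M) (\<phi> ` (U \<inter> F -` V)) (\<lambda>x. \<psi> (F (inv_into U \<phi> x)) k))"

text \<open>Coordinates on the second factor are shifted past those on the first.\<close>

definition prod_manifold :: "'a manifold \<Rightarrow> 'b manifold \<Rightarrow> ('a \<times> 'b) manifold" where
  "prod_manifold M N =
     \<lparr> mtop = prod_topology (mtop M) (mtop N),
       mdim = mdim M + mdim N,
       atlas = {(U \<times> V, \<lambda>(x, y) i. if i < mdim M then \<phi> x i else \<psi> y (i - mdim M)) | U \<phi> V \<psi>.
                  (U, \<phi>) \<in> atlas M \<and> (V, \<psi>) \<in> atlas N} \<rparr>"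

text \<open>
  The algebra of smooth real functions on \<open>M\<close>. Since HOL functions are total, functions on \<open>M\<close> are
  represented by their extension by zero outside \<open>M\<close>, so that equality of functions on \<open>M\<close> is
  equality in HOL. The same convention is used for tangent vectors (outside the smooth functions)
  and vector fields (outside \<open>M\<close>); zero, sums and products are then the pointwise ones.
\<close>

definition smooth_functions :: "'a manifold \<Rightarrow> ('a \<Rightarrow> real) set" where
  "smooth_functions M =
     {f. (\<forall>(U, \<phi>) \<in> atlas M. smooth_on (mdim M) (\<phi> ` U) (\<lambda>x. f (inv_into U \<phi> x))) \<and>
         (\<forall>x. x \<notin> topspace (mtop M) \<longrightarrow> f x = 0)}"

text \<open>Tangent vectors at \<open>p\<close> are the derivations at \<open>p\<close> of the algebra of smooth functions.\<close>

type_synonym 'a tangent = "('a \<Rightarrow> real) \<Rightarrow> real"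

definition tangent_space :: "'a manifold \<Rightarrow> 'a \<Rightarrow> 'a tangent set" where
  "tangent_space M p =
     {v. (\<forall>f \<in> smooth_functions M. \<forall>g \<in> smooth_functions M.
            v (\<lambda>x. f x + g x) = v f + v g \<and>
            v (\<lambda>x. f x * g x) = v f * g p + f p * v g) \<and>
         (\<forall>c. \<forall>f \<in> smooth_functions M. v (\<lambda>x. c * f x) = c * v f) \<and>
         (\<forall>f. f \<notin> smooth_functions M \<longrightarrow> v f = 0)}"

definition differential :: "'a manifold \<Rightarrow> 'b manifold \<Rightarrow> ('a \<Rightarrow> 'b) \<Rightarrow> 'a tangent \<Rightarrow> 'b tangent" where
  "differential M N F v =
     (\<lambda>f. if f \<in> smooth_functions N
          then v (\<lambda>x. if x \<in> topspace (mtop M) then f (F x) else 0) else 0)"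

type_synonym 'a vfield = "'a \<Rightarrow> 'a tangent"

definition vector_fields :: "'a manifold \<Rightarrow> 'a vfield set" where
  "vector_fields M =
     {X. (\<forall>p \<in> topspace (mtop M). X p \<in> tangent_space M p) \<and>
         (\<forall>p. p \<notin> topspace (mtop M) \<longrightarrow> X p = (\<lambda>f. 0)) \<and>
         (\<forall>f \<in> smooth_functions M. (\<lambda>p. X p f) \<in> smooth_functions M)}"

definition zero_vfield :: "'a vfield" where
  "zero_vfield = (\<lambda>p f. 0)"

definition lie_bracket :: "'a vfield \<Rightarrow> 'a vfield \<Rightarrow> 'a vfield" where
  "lie_bracket X Y = (\<lambda>p f. X p (\<lambda>q. Y q f) - Y p (\<lambda>q. X q f))"

definition vf_inner :: "'a manifold \<Rightarrow> ('a \<Rightarrow> 'a tangent \<Rightarrow> 'a tangent \<Rightarrow> real) \<Rightarrow>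
    'a vfield \<Rightarrow> 'a vfield \<Rightarrow> 'a \<Rightarrow> real" where
  "vf_inner M g X Y = (\<lambda>p. if p \<in> topspace (mtop M) then g p (X p) (Y p) else 0)"

definition riemannian_metric ::
    "'a manifold \<Rightarrow> ('a \<Rightarrow> 'a tangent \<Rightarrow> 'a tangent \<Rightarrow> real) \<Rightarrow> bool" where
  "riemannian_metric M g \<longleftrightarrow>
     (\<forall>p \<in> topspace (mtop M).
        (\<forall>u \<in> tangent_space M p. \<forall>v \<in> tangent_space M p. g p u v = g p v u) \<and>
        (\<forall>u \<in> tangent_space M p. \<forall>v \<in> tangent_space M p. \<forall>w \<in> tangent_space M p. \<forall>a b.
           g p (\<lambda>f. a * u f + b * v f) w = a * g p u w + b * g p v w) \<and>
        (\<forall>u \<in> tangent_space M p. u \<noteq> (\<lambda>f. 0) \<longrightarrow> g p u u > 0)) \<and>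
     (\<forall>X \<in> vector_fields M. \<forall>Y \<in> vector_fields M. vf_inner M g X Y \<in> smooth_functions M)"

text \<open>\<open>D X Y\<close> is the covariant derivative of \<open>Y\<close> in the direction of \<open>X\<close>.\<close>

definition affine_connection ::
    "'a manifold \<Rightarrow> ('a vfield \<Rightarrow> 'a vfield \<Rightarrow> 'a vfield) \<Rightarrow> bool" where
  "affine_connection M D \<longleftrightarrow>
     (\<forall>X \<in> vector_fields M. \<forall>Y \<in> vector_fields M. D X Y \<in> vector_fields M) \<and>
     (\<forall>X \<in> vector_fields M. \<forall>Y \<in> vector_fields M. \<forall>Z \<in> vector_fields M.
        D (\<lambda>p f. X p f + Y p f) Z = (\<lambda>p f. D X Z p f + D Y Z p f) \<and>
        D X (\<lambda>p f. Y p f + Z p f) = (\<lambda>p f. D X Y p f + D X Z p f)) \<and>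
     (\<forall>X \<in> vector_fields M. \<forall>Y \<in> vector_fields M. \<forall>c.
        D X (\<lambda>p f. c * Y p f) = (\<lambda>p f. c * D X Y p f)) \<and>
     (\<forall>X \<in> vector_fields M. \<forall>Y \<in> vector_fields M. \<forall>a \<in> smooth_functions M.
        D (\<lambda>p f. a p * X p f) Y = (\<lambda>p f. a p * D X Y p f) \<and>
        D X (\<lambda>p f. a p * Y p f) = (\<lambda>p f. X p a * Y p f + a p * D X Y p f))"

definition levi_civita :: "'a manifold \<Rightarrow> ('a \<Rightarrow> 'a tangent \<Rightarrow> 'a tangent \<Rightarrow> real) \<Rightarrow>
    ('a vfield \<Rightarrow> 'a vfield \<Rightarrow> 'a vfield) \<Rightarrow> bool" where
  "levi_civita M g D \<longleftrightarrow>
     affine_connection M D \<and>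
     (\<forall>X \<in> vector_fields M. \<forall>Y \<in> vector_fields M.
        (\<lambda>p f. D X Y p f - D Y X p f) = lie_bracket X Y) \<and>
     (\<forall>X \<in> vector_fields M. \<forall>Y \<in> vector_fields M. \<forall>Z \<in> vector_fields M. \<forall>p \<in> topspace (mtop M).
        X p (vf_inner M g Y Z) = g p (D X Y p) (Z p) + g p (Y p) (D X Z p))"

definition concurrent ::
    "'a manifold \<Rightarrow> ('a vfield \<Rightarrow> 'a vfield \<Rightarrow> 'a vfield) \<Rightarrow> 'a vfield \<Rightarrow> bool" where
  "concurrent M D X \<longleftrightarrow> X \<in> vector_fields M \<and> (\<forall>Y \<in> vector_fields M. D Y X = Y)"

definition lie_group :: "('a, 'b) monoid_scheme \<Rightarrow> 'a manifold \<Rightarrow> bool" where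
  "lie_group G M \<longleftrightarrow>
     group G \<and> smooth_manifold M \<and> topspace (mtop M) = carrier G \<and>
     smooth_map (prod_manifold M M) M (\<lambda>(x, y). x \<otimes>\<^bsub>G\<^esub> y) \<and>
     smooth_map M M (\<lambda>x. inv\<^bsub>G\<^esub> x)"

definition left_invariant_vfield ::
    "('a, 'b) monoid_scheme \<Rightarrow> 'a manifold \<Rightarrow> 'a vfield \<Rightarrow> bool" where
  "left_invariant_vfield G M X \<longleftrightarrow>
     X \<in> vector_fields M \<and>
     (\<forall>a \<in> carrier G. \<forall>p \<in> carrier G.
        differential M M (\<lambda>x. a \<otimes>\<^bsub>G\<^esub> x) (X p) = X (a \<otimes>\<^bsub>G\<^esub> p))"

definition left_invariant_metric :: "('a, 'b) monoid_scheme \<Rightarrow> 'a manifold \<Rightarrow>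
    ('a \<Rightarrow> 'a tangent \<Rightarrow> 'a tangent \<Rightarrow> real) \<Rightarrow> bool" where
  "left_invariant_metric G M h \<longleftrightarrow>
     riemannian_metric M h \<and>
     (\<forall>a \<in> carrier G. \<forall>p \<in> carrier G. \<forall>u \<in> tangent_space M p. \<forall>v \<in> tangent_space M p.
        h (a \<otimes>\<^bsub>G\<^esub> p) (differential M M (\<lambda>x. a \<otimes>\<^bsub>G\<^esub> x) u) (differential M M (\<lambda>x. a \<otimes>\<^bsub>G\<^esub> x) v)
        = h p u v)"

text \<open>
  The library's \<^const>\<open>simply_connected\<close> is tied to the topology of a type class; this is
  its counterpart for abstract topologies: path connected with trivial fundamental group.
\<close>

definition simply_connected_space :: "'a topology \<Rightarrow> bool" where
  "simply_connected_space T \<longleftrightarrow>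
     path_connected_space T \<and>
     (\<forall>c. pathin T c \<and> c 1 = c 0 \<longrightarrow>
        homotopic_with (\<lambda>r. r 0 = c 0 \<and> r 1 = c 0) (top_of_set {0..1}) T c (\<lambda>t. c 0))"

end

theory Submission
  imports Defs
begin

text \<open>
  The squared length \<open>h(X, X)\<close> of a left-invariant field \<open>X\<close> is constant, since left translations are
  isometries that act transitively. If \<open>X\<close> is moreover concurrent, metric compatibility makes
  its derivative along \<open>X\<close> itself equal to \<open>h(\<nabla>\<^sub>X X, X) + h(X, \<nabla>\<^sub>X X) = 2 h(X, X)\<close>.
  Hence \<open>h(X, X) = 0\<close>, and \<open>X\<close> vanishes because \<open>h\<close> is positive definite.
\<close>

text \<open>
  If \<open>f\<close> has the constant value \<open>c\<close> on \<open>M\<close>, then \<open>f\<^sup>2 = c f\<close>, and the product rule at \<open>p\<close> gives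
  \<open>2 c v(f) = c v(f)\<close>; if \<open>c = 0\<close>, then \<open>f = 0 f\<close>. Using \<open>f\<close> itself in place of the constant \<open>1\<close>
  avoids a proof that the latter is smooth.
\<close>

lemma tangent_vector_kills_constants:
  assumes v: "v \<in> tangent_space M p" and p: "p \<in> topspace (mtop M)"
    and f: "f \<in> smooth_functions M"
    and const: "\<And>q. q \<in> topspace (mtop M) \<Longrightarrow> f q = c"
  shows "v f = 0"
proof -
  have zero: "f q = 0" if "q \<notin> topspace (mtop M)" for q
    using f that by (simp add: smooth_functions_def)
  have scale: "v (\<lambda>x. d * f x) = d * v f" for d
    using v f by (simp add: tangent_space_def)
  show ?thesis
  proof (cases "c = 0")
    case True
    have "f = (\<lambda>x. 0 * f x)"
      using const zero True by fastforce
    then show ?thesis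
      using scale[of 0] by simp
  next
    case False
    have square: "(\<lambda>x. f x * f x) = (\<lambda>x. c * f x)"
      using const zero by fastforce
    have "v (\<lambda>x. f x * f x) = v f * f p + f p * v f"
      using v f by (simp add: tangent_space_def)
    then have "c * v f = 2 * (c * v f)"
      using scale[of c] square const[OF p] by simp
    then show ?thesis
      using False by simp
  qed
qed

lemma left_invariant_inner_const:
  assumes G: "lie_group G M"
    and h: "left_invariant_metric G M h"
    and X: "left_invariant_vfield G M X" and Y: "left_invariant_vfield G M Y"
    and p: "p \<in> carrier G"
  shows "h p (X p) (Y p) = h \<one>\<^bsub>G\<^esub> (X \<one>\<^bsub>G\<^esub>) (Y \<one>\<^bsub>G\<^esub>)"
proof -
  interpret group G
    using G by (simp add: lie_group_def)
  have T: "topspace (mtop M) = carrier G"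
    using G by (simp add: lie_group_def)
  let ?dL = "differential M M (\<lambda>x. p \<otimes>\<^bsub>G\<^esub> x)"
  have "X \<one>\<^bsub>G\<^esub> \<in> tangent_space M \<one>\<^bsub>G\<^esub>" "Y \<one>\<^bsub>G\<^esub> \<in> tangent_space M \<one>\<^bsub>G\<^esub>"
    using X Y T by (auto simp: left_invariant_vfield_def vector_fields_def)
  then have "h (p \<otimes>\<^bsub>G\<^esub> \<one>\<^bsub>G\<^esub>) (?dL (X \<one>\<^bsub>G\<^esub>)) (?dL (Y \<one>\<^bsub>G\<^esub>))
      = h \<one>\<^bsub>G\<^esub> (X \<one>\<^bsub>G\<^esub>) (Y \<one>\<^bsub>G\<^esub>)"
    using h p one_closed unfolding left_invariant_metric_def by blast
  moreover have "?dL (X \<one>\<^bsub>G\<^esub>) = X (p \<otimes>\<^bsub>G\<^esub> \<one>\<^bsub>G\<^esub>)" "?dL (Y \<one>\<^bsub>G\<^esub>) = Y (p \<otimes>\<^bsub>G\<^esub> \<one>\<^bsub>G\<^esub>)"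
    using X Y p one_closed unfolding left_invariant_vfield_def by blast+
  ultimately show ?thesis
    using p by simp
qed

lemma concurrent_derivative_of_inner_self:
  assumes "levi_civita M h D" and "concurrent M D X" and "p \<in> topspace (mtop M)"
  shows "X p (vf_inner M h X X) = 2 * h p (X p) (X p)"
proof -
  have "X \<in> vector_fields M" "D X X = X"
    using assms(2) by (auto simp: concurrent_def)
  moreover from this have
    "X p (vf_inner M h X X) = h p (D X X p) (X p) + h p (X p) (D X X p)"
    using assms(1,3) unfolding levi_civita_def by blast
  ultimately show ?thesis
    by simp
qed

theorem theorem4:
  fixes G :: "('a, 'b) monoid_scheme"
    and M :: "'a manifold"
    and n :: nat
    and h :: "'a \<Rightarrow> 'a tangent \<Rightarrow> 'a tangent \<Rightarrow> real"
    and D :: "'a vfield \<Rightarrow> 'a vfield \<Rightarrow> 'a vfield"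
  assumes "lie_group G M"
    and "mdim M = n"
    and "simply_connected_space (mtop M)"
    and "left_invariant_metric G M h"
    and "levi_civita M h D"
  shows "\<not> (\<exists>X. left_invariant_vfield G M X \<and> concurrent M D X \<and> X \<noteq> zero_vfield)"
proof
  assume "\<exists>X. left_invariant_vfield G M X \<and> concurrent M D X \<and> X \<noteq> zero_vfield"
  then obtain X where X: "left_invariant_vfield G M X" "concurrent M D X" "X \<noteq> zero_vfield"
    by blast
  have T: "topspace (mtop M) = carrier G"
    using assms(1) by (simp add: lie_group_def)
  have XV: "X \<in> vector_fields M"
    using X(2) by (simp add: concurrent_def)
  have metric: "riemannian_metric M h"
    using assms(4) by (simp add: left_invariant_metric_def)
  have "X p = (\<lambda>f. 0)" for p
  proof (cases "p \<in> topspace (mtop M)")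
    case False
    then show ?thesis
      using XV by (simp add: vector_fields_def)
  next
    case True
    have Xp: "X p \<in> tangent_space M p"
      using XV True by (simp add: vector_fields_def)
    have "vf_inner M h X X \<in> smooth_functions M"
      using metric XV by (simp add: riemannian_metric_def)
    moreover have "vf_inner M h X X q = h \<one>\<^bsub>G\<^esub> (X \<one>\<^bsub>G\<^esub>) (X \<one>\<^bsub>G\<^esub>)"
      if "q \<in> topspace (mtop M)" for q
      using left_invariant_inner_const[OF assms(1,4) X(1) X(1)] that T
      by (simp add: vf_inner_def)
    ultimately have "X p (vf_inner M h X X) = 0"
      by (rule tangent_vector_kills_constants[OF Xp True])
    then have "h p (X p) (X p) = 0"
      using concurrent_derivative_of_inner_self[OF assms(5) X(2) True] by simp
    then show ?thesis
      using metric Xp True unfolding riemannian_metric_def by (metis less_irrefl)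
  qed
  then have "X = zero_vfield"
    by (auto simp: zero_vfield_def)
  with X(3) show False ..
qed

end
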